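(* Let $d\geq 3$ and consider the following curves in $\mathbb{P}^2$ over $\mathbb{C}$: $$\mathcal{F}=V(x^d+y^d+z^d),\quad \mathcal{B}_z=V(x^d-y^d),\quad \mathcal{M}_x=V(z^d+2y^d),\quad \mathcal{N}_y=V(z^d+2x^d).$$ Then: (1) the line arrangement $\mathcal{B}_z\cup\mathcal{M}_x\cup\mathcal{N}_y$ is a free curve of degree $3d$ with exponents $(d+1,2d-2)$; (2) $V(xyz)\cup\mathcal{B}_z\cup\mathcal{M}_x\cup\mathcal{N}_y$ is a free curve of degree $3d+3$ with exponents $(d+1,2d+1)$; (3) $\mathcal{F}\cup\mathcal{B}_z\cup\mathcal{M}_x\cup\mathcal{N}_y$ is a free curve of degree $4d$ with exponents $(2d-2,2d+1)$.
   Context: Let $S=\mathbb{C}[x,y,z]$. For a reduced curve $\mathcal{C}=V(P)\subset\mathbb{P}^2$ of degree $\hat d$, with $P\in S$ a reduced homogeneous polynomial and partial derivatives $P_x,P_y,P_z$, let $$AR(P)=\{(a,b,c)\in S^3 : aP_x+bP_y+cP_z=0\}$$ be the graded $S$-module of Jacobian syzygies. The curve $\mathcal{C}$ is called free if $AR(P)$ is minimally generated by two homogeneous syzygies, of degrees $r$ and $\hat d-1-r$ (the degree of a syzygy being the common degree of $a,b,c$); these two degrees are called the exponents. The union of curves is defined by the product of their defining polynomials. *)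

theory Defs
  imports
    "HOL-Computational_Algebra.Computational_Algebra"
    "HOL-Library.Product_Plus"
begin

text \<open>
  The ring \<open>\<complex>[x, y, z]\<close> is represented by iterated univariate polynomials, i.e. as
  \<open>\<complex>[x][y][z]\<close>: the innermost indeterminate is \<open>x\<close>, the outermost one is \<open>z\<close>.
  Accordingly \<open>coeff3 P i j k\<close> is the coefficient of \<open>x\<^sup>i y\<^sup>j z\<^sup>k\<close>.
\<close>

type_synonym S = "complex poly poly poly"

definition X :: S where "X = [:[:[:0, 1:]:]:]"
definition Y :: S where "Y = [:[:0, 1:]:]"
definition Z :: S where "Z = [:0, 1:]"

definition coeff3 :: "S \<Rightarrow> nat \<Rightarrow> nat \<Rightarrow> nat \<Rightarrow> complex" where
  "coeff3 P i j k = coeff (coeff (coeff P k) j) i"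

definition deriv_x :: "S \<Rightarrow> S" where "deriv_x = map_poly (map_poly pderiv)"
definition deriv_y :: "S \<Rightarrow> S" where "deriv_y = map_poly pderiv"
definition deriv_z :: "S \<Rightarrow> S" where "deriv_z = pderiv"

text \<open>The zero polynomial counts as homogeneous of every degree.\<close>

definition homogeneous :: "nat \<Rightarrow> S \<Rightarrow> bool" where
  "homogeneous n P \<longleftrightarrow> (\<forall>i j k. coeff3 P i j k \<noteq> 0 \<longrightarrow> i + j + k = n)"

text \<open>
  A curve is given by a defining polynomial; the union of curves is given by the product of
  their defining polynomials. Note that \<open>squarefree P\<close> entails \<open>P \<noteq> 0\<close>.
\<close>

definition reduced_curve :: "nat \<Rightarrow> S \<Rightarrow> bool" where
  "reduced_curve n P \<longleftrightarrow> n \<ge> 1 \<and> homogeneous n P \<and> squarefree P"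

text \<open>Distinctness of the lines follows from squarefreeness of the product.\<close>

definition line_arrangement :: "S \<Rightarrow> bool" where
  "line_arrangement P \<longleftrightarrow>
     squarefree P \<and> (\<exists>L. finite L \<and> (\<forall>l\<in>L. homogeneous 1 l) \<and> P = \<Prod>L)"

definition scale3 :: "S \<Rightarrow> S \<times> S \<times> S \<Rightarrow> S \<times> S \<times> S" where
  "scale3 s v = (case v of (a, b, c) \<Rightarrow> (s * a, s * b, s * c))"

global_interpretation S3: module scale3
  by unfold_locales (auto simp: scale3_def algebra_simps)

definition AR :: "S \<Rightarrow> (S \<times> S \<times> S) set" where
  "AR P = {(a, b, c). a * deriv_x P + b * deriv_y P + c * deriv_z P = 0}"

definition homogeneous3 :: "nat \<Rightarrow> S \<times> S \<times> S \<Rightarrow> bool" where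
  "homogeneous3 n v \<longleftrightarrow>
     (case v of (a, b, c) \<Rightarrow> homogeneous n a \<and> homogeneous n b \<and> homogeneous n c)"

definition minimal_generators :: "(S \<times> S \<times> S) set \<Rightarrow> (S \<times> S \<times> S) set \<Rightarrow> bool" where
  "minimal_generators G M \<longleftrightarrow> S3.span G = M \<and> (\<forall>G'. G' \<subset> G \<longrightarrow> S3.span G' \<noteq> M)"

text \<open>\<open>P\<close> defines a free curve of degree \<open>n\<close> with exponents \<open>(r, s)\<close>, where \<open>s = n - 1 - r\<close>.\<close>

definition free_curve :: "S \<Rightarrow> nat \<Rightarrow> nat \<times> nat \<Rightarrow> bool" where
  "free_curve P n e \<longleftrightarrow> (case e of (r, s) \<Rightarrow>
     reduced_curve n P \<and> r + s + 1 = n \<and>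
     (\<exists>\<rho> \<sigma>. \<rho> \<noteq> \<sigma> \<and> homogeneous3 r \<rho> \<and> homogeneous3 s \<sigma> \<and> minimal_generators {\<rho>, \<sigma>} (AR P)))"

definition F :: "nat \<Rightarrow> S" where "F d = X ^ d + Y ^ d + Z ^ d"
definition B\<^sub>z :: "nat \<Rightarrow> S" where "B\<^sub>z d = X ^ d - Y ^ d"
definition M\<^sub>x :: "nat \<Rightarrow> S" where "M\<^sub>x d = Z ^ d + 2 * Y ^ d"
definition N\<^sub>y :: "nat \<Rightarrow> S" where "N\<^sub>y d = Z ^ d + 2 * X ^ d"

end

theory Submission
  imports Defs "HOL-Computational_Algebra.Field_as_Ring"
begin

text \<open>
  Put \<open>u = X\<^sup>d\<close>, \<open>v = Y\<^sup>d\<close>, \<open>w = Z\<^sup>d\<close>. In the coordinates \<open>2u\<close>, \<open>2v\<close>, \<open>-w\<close> the three pencils of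
  lines form the Ceva arrangement, so the fields with coefficients \<open>X t\<^sup>k\<close> (where \<open>t\<close> runs through these
  coordinates, \<open>k = 1, 2\<close>) are logarithmic, and the field with \<open>k = -1\<close>, cleared of denominators,
  annihilates all factors, including the Fermat polynomial. Together with the Euler field \<open>E\<close>, two
  suitable fields have Vandermonde-like determinant equal to the defining polynomial \<open>P\<close> up to
  a constant. Subtracting a multiple of \<open>E\<close> turns a logarithmic field into a Jacobian syzygy, and
  Saito's criterion shows that the two syzygies generate: by Cramer's rule every syzygy is a
  combination of them with coefficients \<open>det / P\<close>, and \<open>P\<close> divides these determinants
  because a squarefree polynomial has no factor in common with all of its partial derivatives.
\<close>

section \<open>Derivations\<close>

text \<open>One abstraction serves the three partial derivatives and, later, the directional
  derivatives along vector fields.\<close>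

locale derivation =
  fixes D :: "'a :: comm_ring_1 \<Rightarrow> 'a"
  assumes add: "D (a + b) = D a + D b"
    and mult: "D (a * b) = D a * b + a * D b"
begin

lemma zero [simp]: "D 0 = 0"
  using add[of 0 0] by simp

lemma one [simp]: "D 1 = 0"
  using mult[of 1 1] by simp

lemma minus: "D (- a) = - D a"
  using add[of a "- a"] by (simp add: minus_unique)

lemma diff: "D (a - b) = D a - D b"
  using add[of a "- b"] by (simp add: minus)

lemma of_nat [simp]: "D (of_nat n) = 0"
  by (induction n) (simp_all add: add)

lemma numeral [simp]: "D (numeral n) = 0"
  using of_nat[of "numeral n"] by simp

lemma power: "n > 0 \<Longrightarrow> D (a ^ n) = of_nat n * a ^ (n - 1) * D a"
proof -
  have "D (a ^ Suc k) = of_nat (Suc k) * a ^ k * D a" for k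
    by (induction k) (simp_all add: mult algebra_simps)
  then show "n > 0 \<Longrightarrow> ?thesis" by (metis Suc_diff_1)
qed

lemma sum: "D (sum f A) = (\<Sum>x\<in>A. D (f x))"
  by (induction A rule: infinite_finite_induct) (simp_all add: add)

text \<open>By the Leibniz rule cofactors add like logarithmic derivatives, so a field tangent to
  every factor is tangent to the product.\<close>

lemma log_mult: "D f = K * f \<Longrightarrow> D g = L * g \<Longrightarrow> D (f * g) = (K + L) * (f * g)"
  by (simp add: mult algebra_simps)

end

lemma derivation_map_poly:
  assumes "derivation D"
  shows "derivation (map_poly D)"
proof -
  interpret derivation D by fact
  show ?thesis
  proof
    fix p q :: "'a poly"
    show "map_poly D (p + q) = map_poly D p + map_poly D q"
      by (rule poly_eqI) (simp add: coeff_map_poly add)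
    show "map_poly D (p * q) = map_poly D p * q + p * map_poly D q"
      by (rule poly_eqI)
         (simp add: coeff_map_poly coeff_mult sum mult sum.distrib)
  qed
qed

lemma derivation_pderiv: "derivation (pderiv :: 'a :: idom poly \<Rightarrow> 'a poly)"
  by unfold_locales (simp_all add: pderiv_add pderiv_mult algebra_simps)

interpretation deriv_z: derivation deriv_z
  unfolding deriv_z_def by (rule derivation_pderiv)

interpretation deriv_y: derivation deriv_y
  unfolding deriv_y_def by (intro derivation_map_poly derivation_pderiv)

interpretation deriv_x: derivation deriv_x
  unfolding deriv_x_def by (intro derivation_map_poly derivation_pderiv)

lemma deriv_X [simp]: "deriv_x X = 1" "deriv_y X = 0" "deriv_z X = 0"
  by (simp_all add: deriv_x_def deriv_y_def deriv_z_def X_def map_poly_pCons pderiv_pCons one_pCons)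

lemma deriv_Y [simp]: "deriv_x Y = 0" "deriv_y Y = 1" "deriv_z Y = 0"
  by (simp_all add: deriv_x_def deriv_y_def deriv_z_def Y_def map_poly_pCons pderiv_pCons one_pCons)

lemma deriv_Z [simp]: "deriv_x Z = 0" "deriv_y Z = 0" "deriv_z Z = 1"
  by (simp_all add: deriv_x_def deriv_y_def deriv_z_def Z_def map_poly_pCons pderiv_pCons one_pCons)

section \<open>Polynomials that divide their own derivatives\<close>

lemma pderiv_self_dvd:
  fixes p :: "'a :: {idom, semiring_char_0} poly"
  assumes "p dvd pderiv p"
  shows "pderiv p = 0"
  using assms by (metis degree_pderiv dvd_imp_degree_le pderiv_eq_0_iff diff_le_self
      le_antisym diff_is_0_eq' le_numeral_extra(4) One_nat_def Suc_pred not_gr_zero Suc_n_not_le_n)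

text \<open>\<open>map_poly D\<close> does not raise the degree, so the quotient is a constant
  \<open>c\<close>; then every coefficient divides its own image, and the question descends to the
  coefficient ring.\<close>

lemma map_poly_self_dvd:
  fixes D :: "'a :: idom \<Rightarrow> 'a"
  assumes [simp]: "D 0 = 0" and self: "\<And>a. a dvd D a \<Longrightarrow> D a = 0"
    and dvd: "p dvd map_poly D p"
  shows "map_poly D p = 0"
proof (rule ccontr)
  assume nz: "map_poly D p \<noteq> 0"
  obtain q where q: "map_poly D p = p * q" using dvd by blast
  have "degree (map_poly D p) \<le> degree p"
    by (rule degree_le) (simp add: coeff_map_poly coeff_eq_0)
  moreover have "p \<noteq> 0" "q \<noteq> 0" using nz q by auto
  ultimately have "degree q = 0" by (simp add: q degree_mult_eq)
  then obtain c where "q = [:c:]" by (rule degree_eq_zeroE)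
  then have "D (coeff p n) = coeff p n * c" for n
    using arg_cong[OF q, of "\<lambda>r. coeff r n"] by (simp add: coeff_map_poly mult.commute)
  then have "D (coeff p n) = 0" for n by (intro self) simp
  then have "map_poly D p = 0" by (intro poly_eqI) (simp add: coeff_map_poly)
  with nz show False by simp
qed

lemma deriv_self_dvd:
  "p dvd deriv_x p \<Longrightarrow> deriv_x p = 0"
  "p dvd deriv_y p \<Longrightarrow> deriv_y p = 0"
  "p dvd deriv_z p \<Longrightarrow> deriv_z p = 0"
  unfolding deriv_x_def deriv_y_def deriv_z_def
  by (blast intro: map_poly_0 pderiv_0 map_poly_self_dvd pderiv_self_dvd)+

text \<open>In characteristic 0 a vanishing derivative means degree 0 in that variable; the
  variables are peeled off from the outermost inwards.\<close>

lemma all_derivs_zero: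
  assumes "deriv_x p = 0" "deriv_y p = 0" "deriv_z p = 0"
  obtains c where "p = [:[:[:c:]:]:]"
proof -
  have "degree p = 0" using assms(3) by (simp add: deriv_z_def pderiv_eq_0_iff)
  then obtain p1 where p1: "p = [:p1:]" by (rule degree_eq_zeroE)
  then have "degree p1 = 0"
    using assms(2) by (simp add: deriv_y_def pderiv_eq_0_iff map_poly_pCons)
  then obtain p2 where p2: "p1 = [:p2:]" by (rule degree_eq_zeroE)
  then have "degree p2 = 0"
    using assms(1) by (simp add: deriv_x_def pderiv_eq_0_iff map_poly_pCons p1)
  then obtain c where "p2 = [:c:]" by (rule degree_eq_zeroE)
  with p1 p2 show ?thesis by (intro that) simp
qed

lemma prime_not_dvd_derivs:
  assumes "prime (p :: S)" "p dvd deriv_x p" "p dvd deriv_y p" "p dvd deriv_z p"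
  shows False
proof -
  obtain c where c: "p = [:[:[:c:]:]:]"
    using all_derivs_zero deriv_self_dvd assms(2-4) by metis
  with assms(1) have "c \<noteq> 0" by auto
  then have "is_unit p" by (simp add: c is_unit_const_poly_iff dvd_field_iff)
  with assms(1) show False by (simp add: not_prime_unit)
qed

text \<open>Modulo \<open>p\<close> the Leibniz rule leaves only \<open>D p * q\<close>, and
  \<open>p\<close> does not divide the cofactor \<open>q\<close> because it occurs only once in
  \<open>P\<close>.\<close>

lemma (in derivation) prime_dvd_self:
  assumes "prime_elem p" "p dvd P" "\<not> p ^ 2 dvd P" "p dvd D P"
  shows "p dvd D p"
proof -
  obtain q where q: "P = p * q" using assms(2) by blast
  have "\<not> p dvd q" using assms(3) by (auto simp: q power2_eq_square intro: mult_dvd_mono)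
  have "p dvd D p * q + p * D q" using assms(4) by (simp add: q mult)
  then have "p dvd D p * q" by (simp add: dvd_add_left_iff)
  with \<open>\<not> p dvd q\<close> assms(1) show ?thesis by (simp add: prime_elem_dvd_mult_iff)
qed

text \<open>Factoring \<open>A\<close> out of \<open>gcd (A * a) (A * b)\<close> replaces a Bezout
  identity, which fails in three variables.\<close>

lemma dvd_mult_gcd:
  fixes a :: "'a :: semiring_gcd"
  assumes "P dvd A * a" "P dvd A * b"
  shows "P dvd A * gcd a b"
  using gcd_greatest[OF assms] by (simp add: gcd_mult_left)

text \<open>A prime dividing \<open>P\<close> and all its partial derivatives occurs only once in
  \<open>P\<close>, hence divides its own partial derivatives, which is impossible. So
  \<open>P\<close> and its partial derivatives have gcd 1.\<close>

lemma squarefree_dvd_mult_derivs: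
  fixes P :: S
  assumes sf: "squarefree P"
    and "P dvd A * deriv_x P" "P dvd A * deriv_y P" "P dvd A * deriv_z P"
  shows "P dvd A"
proof -
  define g where "g = gcd P (gcd (deriv_x P) (gcd (deriv_y P) (deriv_z P)))"
  have dvd: "g dvd P" "g dvd deriv_x P" "g dvd deriv_y P" "g dvd deriv_z P"
    by (auto simp: g_def intro: gcd_dvd1 gcd_dvd2 dvd_trans)
  have "is_unit g"
  proof (rule ccontr)
    assume "\<not> is_unit g"
    moreover have "g \<noteq> 0" using sf dvd(1) by auto
    ultimately obtain p where p: "prime p" "p dvd g" using prime_divisor_exists by blast
    have "\<not> p ^ 2 dvd P" using sf p(1) squarefreeD not_prime_unit by blast
    then show False
      using prime_not_dvd_derivs[OF p(1)] p dvd
      by (meson deriv_x.prime_dvd_self deriv_y.prime_dvd_self deriv_z.prime_dvd_self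
          dvd_trans prime_imp_prime_elem)
  qed
  moreover have "P dvd A * g"
    unfolding g_def using assms by (intro dvd_mult_gcd) auto
  ultimately show ?thesis by (simp add: dvd_mult_unit_iff)
qed

section \<open>Homogeneous polynomials\<close>

lemma coeff3_mult:
  "coeff3 (P * Q) i j k = (\<Sum>k'\<le>k. \<Sum>j'\<le>j. \<Sum>i'\<le>i.
     coeff3 P i' j' k' * coeff3 Q (i - i') (j - j') (k - k'))"
  unfolding coeff3_def coeff_mult coeff_sum ..

text \<open>A nonzero coefficient of the product has a nonzero term in its triple convolution sum,
  and the exponents in that term add up.\<close>

lemma homogeneous_mult:
  assumes "homogeneous m P" "homogeneous n Q"
  shows "homogeneous (m + n) (P * Q)"
  unfolding homogeneous_def
proof (intro allI impI)
  fix i j k assume "coeff3 (P * Q) i j k \<noteq> 0"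
  then obtain k' where "k' \<in> {..k}" and
    "(\<Sum>j'\<le>j. \<Sum>i'\<le>i. coeff3 P i' j' k' * coeff3 Q (i - i') (j - j') (k - k')) \<noteq> 0"
    unfolding coeff3_mult by (rule sum.not_neutral_contains_not_neutral)
  moreover from this(2) obtain j' where "j' \<in> {..j}" and
    "(\<Sum>i'\<le>i. coeff3 P i' j' k' * coeff3 Q (i - i') (j - j') (k - k')) \<noteq> 0"
    by (rule sum.not_neutral_contains_not_neutral)
  moreover from this(2) obtain i' where "i' \<in> {..i}"
    and nz: "coeff3 P i' j' k' * coeff3 Q (i - i') (j - j') (k - k') \<noteq> 0"
    by (rule sum.not_neutral_contains_not_neutral)
  ultimately have ijk: "i' \<le> i" "j' \<le> j" "k' \<le> k" by simp_all
  have "i' + j' + k' = m"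
    using assms(1) nz unfolding homogeneous_def by (metis mult_zero_left)
  moreover have "(i - i') + (j - j') + (k - k') = n"
    using assms(2) nz unfolding homogeneous_def by (metis mult_zero_right)
  ultimately show "i + j + k = m + n" using ijk by linarith
qed

lemma homogeneous_0 [simp]: "homogeneous n 0"
  by (simp add: homogeneous_def coeff3_def)

lemma homogeneous_add: "homogeneous n P \<Longrightarrow> homogeneous n Q \<Longrightarrow> homogeneous n (P + Q)"
  unfolding homogeneous_def
proof (intro allI impI)
  fix i j k
  assume PQ: "\<forall>i j k. coeff3 P i j k \<noteq> 0 \<longrightarrow> i + j + k = n" "\<forall>i j k. coeff3 Q i j k \<noteq> 0 \<longrightarrow> i + j + k = n"
    and "coeff3 (P + Q) i j k \<noteq> 0"
  then have "coeff3 P i j k \<noteq> 0 \<or> coeff3 Q i j k \<noteq> 0" by (auto simp: coeff3_def)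
  with PQ show "i + j + k = n" by blast
qed

lemma homogeneous_minus: "homogeneous n P \<Longrightarrow> homogeneous n (- P)"
  by (simp add: homogeneous_def coeff3_def)

lemma homogeneous_diff: "homogeneous n P \<Longrightarrow> homogeneous n Q \<Longrightarrow> homogeneous n (P - Q)"
  using homogeneous_add[of n P "- Q"] by (simp add: homogeneous_minus)

lemma homogeneous_const: "homogeneous 0 [:[:[:c:]:]:]"
  by (auto simp: homogeneous_def coeff3_def coeff_pCons split: nat.splits)

lemma of_nat_S: "(of_nat n :: S) = [:[:[:of_nat n:]:]:]"
  by (simp add: of_nat_poly)

lemma homogeneous_of_nat: "homogeneous 0 (of_nat n)"
  unfolding of_nat_S by (rule homogeneous_const)

lemma homogeneous_numeral: "homogeneous 0 (numeral n)"
  using homogeneous_of_nat[of "numeral n"] by simp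

lemma is_unit_of_nat: "n > 0 \<Longrightarrow> is_unit (of_nat n :: S)"
  by (simp add: of_nat_S is_unit_const_poly_iff dvd_field_iff)

lemma homogeneous_axis: "homogeneous (Suc 0) X" "homogeneous (Suc 0) Y" "homogeneous (Suc 0) Z"
  by (auto simp: homogeneous_def coeff3_def X_def Y_def Z_def coeff_pCons split: nat.splits)

lemma homogeneous_power: "homogeneous m P \<Longrightarrow> homogeneous (m * n) (P ^ n)"
proof (induction n)
  case 0
  show ?case using homogeneous_const[of 1] by (simp add: one_pCons)
next
  case (Suc n)
  then show ?case using homogeneous_mult[of m P "m * n" "P ^ n"] by simp
qed

lemma homogeneous_mult_const:
  "homogeneous 0 c \<Longrightarrow> homogeneous n P \<Longrightarrow> homogeneous n (c * P)"
  using homogeneous_mult[of 0 c n P] by simp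

lemma homogeneous_mult_linear:
  "homogeneous n P \<Longrightarrow> homogeneous (Suc 0) l \<Longrightarrow> homogeneous (Suc n) (P * l)"
  using homogeneous_mult[of n P "Suc 0" l] by simp

lemma homogeneous_axis_power:
  "homogeneous n (X ^ n)" "homogeneous n (Y ^ n)" "homogeneous n (Z ^ n)"
  using homogeneous_axis[THEN homogeneous_power, of n] by simp_all

lemmas homogeneous_intros = homogeneous_add homogeneous_diff homogeneous_minus
  homogeneous_mult_const homogeneous_mult_linear homogeneous_of_nat homogeneous_numeral
  homogeneous_axis homogeneous_axis_power

section \<open>Saito's criterion\<close>

definition det3 :: "'a :: comm_ring_1 \<times> 'a \<times> 'a \<Rightarrow> 'a \<times> 'a \<times> 'a \<Rightarrow> 'a \<times> 'a \<times> 'a \<Rightarrow> 'a" where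
  "det3 u v w = (case (u, v, w) of ((a, b, c), (a', b', c'), (a'', b'', c'')) \<Rightarrow>
     a * (b' * c'' - c' * b'') - b * (a' * c'' - c' * a'') + c * (a' * b'' - b' * a''))"

text \<open>Triples are read as vector fields, so that a Jacobian syzygy of \<open>P\<close> is a
  field annihilating \<open>P\<close>.\<close>

definition dir_deriv :: "S \<times> S \<times> S \<Rightarrow> S \<Rightarrow> S" where
  "dir_deriv v P = (case v of (a, b, c) \<Rightarrow> a * deriv_x P + b * deriv_y P + c * deriv_z P)"

lemma AR_iff: "v \<in> AR P \<longleftrightarrow> dir_deriv v P = 0"
  by (cases v) (simp add: AR_def dir_deriv_def)

interpretation dir_deriv: derivation "dir_deriv v"
  by (cases v; unfold_locales)
     (simp_all add: dir_deriv_def deriv_x.add deriv_y.add deriv_z.add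
       deriv_x.mult deriv_y.mult deriv_z.mult algebra_simps)

lemma dir_deriv_XYZ [simp]:
  "dir_deriv (a, b, c) X = a" "dir_deriv (a, b, c) Y = b" "dir_deriv (a, b, c) Z = c"
  by (simp_all add: dir_deriv_def)

lemma dir_deriv_add: "dir_deriv (v + w) P = dir_deriv v P + dir_deriv w P"
  by (cases v; cases w) (simp add: dir_deriv_def algebra_simps)

lemma dir_deriv_scale3: "dir_deriv (scale3 s v) P = s * dir_deriv v P"
  by (cases v) (simp add: dir_deriv_def scale3_def algebra_simps)

lemma dir_deriv_diff: "dir_deriv (v - w) P = dir_deriv v P - dir_deriv w P"
  by (cases v; cases w) (simp add: dir_deriv_def algebra_simps)

lemma subspace_AR: "S3.subspace (AR P)"
  by (rule S3.subspaceI)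
     (auto simp: AR_iff dir_deriv_add dir_deriv_scale3, simp add: dir_deriv_def zero_prod_def)

text \<open>The error terms come from the triple product expansion of \<open>E \<times> (\<nabla>P \<times> (\<tau> \<times> \<sigma>))\<close>.\<close>

lemma cross_gradient:
  fixes x y z :: "'a :: comm_ring_1"
  assumes N: "x * px + y * py + z * pz = N"
    and t: "a * px + b * py + c * pz = 0" and s: "a' * px + b' * py + c' * pz = 0"
  defines "\<Delta> \<equiv> det3 (x, y, z) (a, b, c) (a', b', c')"
  shows "\<Delta> * px = N * (b * c' - c * b')"
    and "\<Delta> * py = N * (c * a' - a * c')"
    and "\<Delta> * pz = N * (a * b' - b * a')"
proof -
  have "\<Delta> * px = (x * px + y * py + z * pz) * (b * c' - c * b')
      + (a' * px + b' * py + c' * pz) * (y * c - z * b)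
      - (a * px + b * py + c * pz) * (y * c' - z * b')"
    by (simp add: \<Delta>_def det3_def algebra_simps)
  then show "\<Delta> * px = N * (b * c' - c * b')" by (simp add: N t s)
  have "\<Delta> * py = (x * px + y * py + z * pz) * (c * a' - a * c')
      + (a' * px + b' * py + c' * pz) * (z * a - x * c)
      - (a * px + b * py + c * pz) * (z * a' - x * c')"
    by (simp add: \<Delta>_def det3_def algebra_simps)
  then show "\<Delta> * py = N * (c * a' - a * c')" by (simp add: N t s)
  have "\<Delta> * pz = (x * px + y * py + z * pz) * (a * b' - b * a')
      + (a' * px + b' * py + c' * pz) * (x * b - y * a)
      - (a * px + b * py + c * pz) * (x * b' - y * a')"
    by (simp add: \<Delta>_def det3_def algebra_simps)
  then show "\<Delta> * pz = N * (a * b' - b * a')" by (simp add: N t s)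
qed

text \<open>The identities of \<open>cross_gradient\<close>, weighted by \<open>t1\<close>,
  \<open>t2\<close>, \<open>t3\<close>, add up to the expansion of the determinant along its first
  row.\<close>

lemma det3_gradient:
  fixes x y z :: "'a :: comm_ring_1"
  assumes "x * px + y * py + z * pz = N"
    and "a * px + b * py + c * pz = 0" and "a' * px + b' * py + c' * pz = 0"
  shows "N * det3 (t1, t2, t3) (a, b, c) (a', b', c') =
    det3 (x, y, z) (a, b, c) (a', b', c') * (t1 * px + t2 * py + t3 * pz)" (is "_ = ?\<Delta> * _")
proof -
  have "?\<Delta> * (t1 * px + t2 * py + t3 * pz) = t1 * (?\<Delta> * px) + t2 * (?\<Delta> * py) + t3 * (?\<Delta> * pz)"
    by (simp add: algebra_simps)
  also have "\<dots> = N * det3 (t1, t2, t3) (a, b, c) (a', b', c')"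
    unfolding cross_gradient[OF assms] by (simp add: det3_def algebra_simps)
  finally show ?thesis ..
qed

text \<open>Cramer's rule cleared of denominators, so that it holds over any commutative
  ring.\<close>

lemma cramer_det3:
  fixes x y z :: "'a :: comm_ring_1"
  shows "det3 (x, y, z) (a, b, c) (a', b', c') * t1 =
      det3 (t1, t2, t3) (a, b, c) (a', b', c') * x
    + det3 (x, y, z) (t1, t2, t3) (a', b', c') * a + det3 (x, y, z) (a, b, c) (t1, t2, t3) * a'"
   "det3 (x, y, z) (a, b, c) (a', b', c') * t2 =
      det3 (t1, t2, t3) (a, b, c) (a', b', c') * y
    + det3 (x, y, z) (t1, t2, t3) (a', b', c') * b + det3 (x, y, z) (a, b, c) (t1, t2, t3) * b'"
   "det3 (x, y, z) (a, b, c) (a', b', c') * t3 =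
      det3 (t1, t2, t3) (a, b, c) (a', b', c') * z
    + det3 (x, y, z) (t1, t2, t3) (a', b', c') * c + det3 (x, y, z) (a, b, c) (t1, t2, t3) * c'"
  by (simp_all add: det3_def algebra_simps)

text \<open>By \<open>cross_gradient\<close> the determinant times any partial derivative of
  \<open>P\<close> is a multiple of \<open>P\<close>; squarefreeness removes the partial
  derivatives.\<close>

lemma det_dvd:
  assumes sf: "squarefree P" and euler: "dir_deriv (X, Y, Z) P = of_nat n * P"
    and "v \<in> AR P" "w \<in> AR P"
  shows "P dvd det3 (X, Y, Z) v w"
proof -
  obtain a b c a' b' c' where vw: "v = (a, b, c)" "w = (a', b', c')" by (metis prod_cases3)
  have "X * deriv_x P + Y * deriv_y P + Z * deriv_z P = of_nat n * P"
    "a * deriv_x P + b * deriv_y P + c * deriv_z P = 0"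
    "a' * deriv_x P + b' * deriv_y P + c' * deriv_z P = 0"
    using assms(2-) unfolding vw AR_iff dir_deriv_def by simp_all
  from cross_gradient[OF this] show ?thesis
    unfolding vw by - (rule squarefree_dvd_mult_derivs[OF sf], simp_all)
qed

lemma saito:
  assumes sf: "squarefree P" and euler: "dir_deriv (X, Y, Z) P = of_nat n * P" and n: "n > 0"
    and v: "v \<in> AR P" and w: "w \<in> AR P"
    and det: "det3 (X, Y, Z) v w = c * P" and c: "is_unit c"
  shows "S3.span {v, w} = AR P"
proof
  show "S3.span {v, w} \<subseteq> AR P"
    using v w by (intro S3.span_minimal subspace_AR) simp
  show "AR P \<subseteq> S3.span {v, w}"
  proof
    fix t assume t: "t \<in> AR P"
    have P0: "P \<noteq> 0" using sf by auto
    obtain v1 v2 v3 w1 w2 w3 t1 t2 t3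
      where vwt: "v = (v1, v2, v3)" "w = (w1, w2, w3)" "t = (t1, t2, t3)" by (metis prod_cases3)
    obtain A where A: "det3 (X, Y, Z) t w = P * A"
      using det_dvd[OF sf euler t w] by blast
    obtain B where B: "det3 (X, Y, Z) v t = P * B"
      using det_dvd[OF sf euler v t] by blast
    \<comment> \<open>The right side vanishes for a syzygy \<open>t\<close>, so three syzygies are
      dependent and the Euler term in Cramer's rule drops out.\<close>
    have "of_nat n * P * det3 t v w = det3 (X, Y, Z) v w * dir_deriv t P"
      using euler v w unfolding vwt AR_iff dir_deriv_def split_conv by (rule det3_gradient)
    then have D: "det3 t v w = 0" using t n P0 by (simp add: AR_iff)
    obtain c' where c': "c' * c = 1" using c by (metis dvd_def mult.commute)
    \<comment> \<open>One coordinate at a time: \<open>s\<close>, \<open>r\<close>,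
      \<open>p\<close>, \<open>q\<close> are the matching coordinates of \<open>t\<close>, the Euler
      field, \<open>v\<close> and \<open>w\<close>. Both sides carry a factor \<open>P\<close>,
      which is cancelled next.\<close>
    have "P * (c * s) = P * (A * p + B * q)" 
      if "det3 (X, Y, Z) v w * s = det3 t v w * r + det3 (X, Y, Z) t w * p + det3 (X, Y, Z) v t * q"
      for s r p q
      using that by (simp add: A B D det algebra_simps)
    then have E: "s = (c' * A) * p + (c' * B) * q" 
      if "det3 (X, Y, Z) v w * s = det3 t v w * r + det3 (X, Y, Z) t w * p + det3 (X, Y, Z) v t * q"
      for s r p q
      using that P0 c' by (metis (no_types, lifting) distrib_left mult.assoc mult_1 mult_cancel_left)
    have "t = scale3 (c' * A) v + scale3 (c' * B) w"
      using E[OF cramer_det3(1)[of X Y Z v1 v2 v3 w1 w2 w3 t1 t2 t3, folded vwt]]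
        E[OF cramer_det3(2)[of X Y Z v1 v2 v3 w1 w2 w3 t2 t1 t3, folded vwt]]
        E[OF cramer_det3(3)[of X Y Z v1 v2 v3 w1 w2 w3 t3 t1 t2, folded vwt]]
      by (simp add: vwt scale3_def)
    then show "t \<in> S3.span {v, w}"
      by (simp add: S3.span_add S3.span_scale S3.span_base)
  qed
qed

section \<open>From logarithmic fields to free curves\<close>

lemma det3_same: "det3 e v v = 0"
  by (cases e; cases v) (simp add: det3_def algebra_simps)

lemma det3_scale3: "det3 e (scale3 s v) v = 0" "det3 e v (scale3 s v) = 0"
  by (cases e; cases v; simp add: det3_def scale3_def algebra_simps)+

lemma free_curve_criterion:
  assumes "reduced_curve n P" and euler: "dir_deriv (X, Y, Z) P = of_nat n * P"
    and rs: "r + s + 1 = n"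
    and v: "v \<in> AR P" "homogeneous3 r v" and w: "w \<in> AR P" "homogeneous3 s w"
    and det: "det3 (X, Y, Z) v w = c * P" and c: "is_unit c"
  shows "free_curve P n (r, s)"
proof -
  have sf: "squarefree P" and n: "n > 0" using assms(1) by (auto simp: reduced_curve_def)
  have nz: "det3 (X, Y, Z) v w \<noteq> 0" using det c sf by auto
  have "v \<noteq> w" using nz det3_same by metis
  moreover have span: "S3.span {v, w} = AR P" by (rule saito[OF sf euler n v(1) w(1) det c])
  \<comment> \<open>A proper subset lies in a singleton; if one syzygy generated everything, the
    other would be a multiple of it and the determinant would vanish.\<close>
  moreover have "S3.span G \<noteq> AR P" if "G \<subset> {v, w}" for G
  proof
    assume G: "S3.span G = AR P"
    from that have "G \<subseteq> {v} \<or> G \<subseteq> {w}" by auto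
    then have "w \<in> S3.span {v} \<or> v \<in> S3.span {w}"
      using v(1) w(1) G S3.span_mono by blast
    then show False using nz by (auto simp: S3.span_singleton det3_scale3)
  qed
  ultimately show ?thesis
    unfolding free_curve_def minimal_generators_def split_conv
    by (intro conjI assms(1) rs exI[of _ v] exI[of _ w] v(2) w(2)) auto
qed

lemma homogeneous3_diff_euler:
  assumes "homogeneous3 (Suc r) v" "homogeneous r K"
  shows "homogeneous3 (Suc r) (scale3 (of_nat n) v - scale3 K (X, Y, Z))"
proof -
  obtain a b c where v: "v = (a, b, c)" by (rule prod_cases3)
  have *: "homogeneous (Suc r) (of_nat n * p - K * l)"
    if "homogeneous (Suc r) p" "homogeneous (Suc 0) l" for p l
    by (intro homogeneous_diff homogeneous_mult_const[OF homogeneous_of_nat]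
        homogeneous_mult_linear[OF assms(2)] that)
  show ?thesis
    using assms(1) by (simp only: v homogeneous3_def scale3_def split_conv minus_prod_def
        fst_conv snd_conv * homogeneous_axis)
qed

text \<open>Since the Euler field multiplies \<open>P\<close> by \<open>n\<close>, subtracting
  \<open>K\<close> times it from \<open>n\<close> times \<open>v\<close> gives a syzygy of the same
  degree. Here \<open>r\<close> and \<open>s\<close> are the degrees of the cofactors, one below the
  exponents.\<close>

lemma free_curve_if_logarithmic:
  assumes P: "reduced_curve n P" and euler: "dir_deriv (X, Y, Z) P = of_nat n * P"
    and rs: "r + s + 3 = n"
    and v: "dir_deriv v P = K * P" "homogeneous3 (Suc r) v" "homogeneous r K"
    and w: "dir_deriv w P = L * P" "homogeneous3 (Suc s) w" "homogeneous s L"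
    and det: "det3 (X, Y, Z) v w = c * P" and c: "is_unit c"
  shows "free_curve P n (Suc r, Suc s)"
proof (rule free_curve_criterion[OF P euler])
  let ?n = "of_nat n :: S"
  let ?v = "scale3 ?n v - scale3 K (X, Y, Z)" and ?w = "scale3 ?n w - scale3 L (X, Y, Z)"
  show "Suc r + Suc s + 1 = n" using rs by simp
  show "?v \<in> AR P" "?w \<in> AR P"
    using v(1) w(1) euler by (simp_all add: AR_iff dir_deriv_diff dir_deriv_scale3)
  show "homogeneous3 (Suc r) ?v" "homogeneous3 (Suc s) ?w"
    using v(2,3) w(2,3) by (simp_all only: homogeneous3_diff_euler)
  show "det3 (X, Y, Z) ?v ?w = (?n ^ 2 * c) * P"
  proof -
    \<comment> \<open>Adding multiples of the first row changes nothing; scaling the other two rows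
      contributes \<open>?n ^ 2\<close>.\<close>
    have "det3 (X, Y, Z) ?v ?w = ?n ^ 2 * det3 (X, Y, Z) v w"
      by (cases v; cases w) (simp add: det3_def scale3_def algebra_simps power2_eq_square)
    then show ?thesis by (simp add: det mult.assoc)
  qed
  show "is_unit (?n ^ 2 * c)"
    using c rs by (auto simp: is_unit_mult_iff is_unit_power_iff intro!: is_unit_of_nat)
qed

section \<open>Coprimality and reducedness\<close>

text \<open>A divisor of a nonzero constant is constant, and a constant dividing \<open>f\<close>
  divides all its coefficients, one of which is a unit.\<close>

lemma coprime_const_poly:
  fixes a :: "'a :: {idom_divide, algebraic_semidom}"
  assumes "a \<noteq> 0" "is_unit (coeff f k)"
  shows "coprime [:a:] f"
proof (rule coprimeI)
  fix c assume c: "c dvd [:a:]" "c dvd f"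
  have "degree c = 0" using dvd_imp_degree_le[OF c(1)] assms(1) by simp
  then obtain c0 where c0: "c = [:c0:]" by (rule degree_eq_zeroE)
  have "c0 dvd coeff f k" using c(2) by (simp add: c0 const_poly_dvd_iff)
  then show "is_unit c" using assms(2) by (simp add: c0 is_unit_const_poly_iff dvd_unit_imp_unit)
qed

lemma coprime_const_const:
  fixes a b :: "'a :: {idom_divide, algebraic_semidom}"
  assumes "a \<noteq> 0" "coprime a b"
  shows "coprime [:a:] [:b:]"
proof (rule coprimeI)
  fix c assume c: "c dvd [:a:]" "c dvd [:b:]"
  have "degree c = 0" using dvd_imp_degree_le[OF c(1)] assms(1) by simp
  then obtain c0 where "c = [:c0:]" by (rule degree_eq_zeroE)
  with c assms(2) show "is_unit c" by (auto simp: is_unit_const_poly_iff intro: coprime_common_divisor)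
qed

lemma X_power: "X ^ n = [:[:[:0, 1:] ^ n:]:]"
  by (simp add: X_def poly_const_pow)

lemma Y_power: "Y ^ n = [:monom 1 n:]"
  by (simp add: Y_def poly_const_pow monom_altdef)

lemma Z_power: "Z ^ n = monom 1 n"
  by (simp add: Z_def monom_altdef)

text \<open>The second polynomial is monic in \<open>Z\<close>, while the first does not involve
  \<open>Z\<close>.\<close>

lemma coprime_Z: "a \<noteq> 0 \<Longrightarrow> n > 0 \<Longrightarrow> coprime [:a:] (Z ^ n + [:b:])"
  by (rule coprime_const_poly[of _ _ n]) (auto simp: Z_power coeff_pCons split: nat.splits)

lemma coprime_XY: "coprime X Y"
proof -
  have "coprime [:[:0, 1 :: complex:]:] [:0, 1:]"
    by (rule coprime_const_poly[of _ _ 1]) simp_all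
  then show ?thesis
    unfolding X_def Y_def by (intro coprime_const_const) simp_all
qed

lemma coprime_XZ: "coprime X Z" and coprime_YZ: "coprime Y Z"
  using coprime_Z[of _ 1 0] by (simp_all add: X_def Y_def)

section \<open>Squarefreeness from coprime derivatives\<close>

lemma (in derivation) square_dvd:
  assumes "p ^ 2 dvd f"
  shows "p dvd D f"
  using assms by (auto simp: power2_eq_square mult elim!: dvdE)

text \<open>A double factor survives in every derivative. The units \<open>c\<close> and
  \<open>c'\<close> absorb constants such as \<open>d\<close> and 2.\<close>

lemma squarefree_if_coprime_derivs:
  fixes f :: "'a :: {idom_divide, algebraic_semidom}"
  assumes "derivation D" "derivation D'" "D f = c * g" "D' f = c' * h"
    and "is_unit c" "is_unit c'" "coprime g h"
  shows "squarefree f"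
proof (rule squarefreeI)
  fix p assume "p ^ 2 dvd f"
  then have "p dvd c * g" "p dvd c' * h"
    using derivation.square_dvd assms(1-4) by metis+
  then have "p dvd g" "p dvd h" using assms(5,6) by (simp_all add: dvd_mult_unit_iff')
  with assms(7) show "is_unit p" by (rule coprime_common_divisor)
qed

lemma squarefree_linear_form:
  fixes l :: S
  assumes "is_unit (deriv_x l) \<or> is_unit (deriv_y l) \<or> is_unit (deriv_z l)"
  shows "squarefree l"
  using assms deriv_x.square_dvd deriv_y.square_dvd deriv_z.square_dvd
  by (meson dvd_unit_imp_unit squarefreeI)

context
  fixes d :: nat
  assumes d: "d > 0"
begin

lemma deriv_powers:
  "deriv_x (X ^ d) = of_nat d * X ^ (d - 1)" "deriv_y (X ^ d) = 0" "deriv_z (X ^ d) = 0"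
  "deriv_x (Y ^ d) = 0" "deriv_y (Y ^ d) = of_nat d * Y ^ (d - 1)" "deriv_z (Y ^ d) = 0"
  "deriv_x (Z ^ d) = 0" "deriv_y (Z ^ d) = 0" "deriv_z (Z ^ d) = of_nat d * Z ^ (d - 1)"
  using d by (simp_all add: deriv_x.power deriv_y.power deriv_z.power)

lemma is_unit_of_nat_d: "is_unit (of_nat d :: S)" "is_unit (2 * of_nat d :: S)"
  using d is_unit_of_nat[of d] is_unit_of_nat[of "2 * d"] by simp_all

lemma squarefree_factors: "squarefree (B\<^sub>z d)" "squarefree (M\<^sub>x d)" "squarefree (N\<^sub>y d)" "squarefree (F d)"
proof -
  note D = deriv_x.derivation_axioms deriv_y.derivation_axioms deriv_z.derivation_axioms
  note simps = deriv_x.add deriv_x.diff deriv_x.mult deriv_y.add deriv_y.diff deriv_y.mult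
    deriv_z.add deriv_z.diff deriv_z.mult deriv_powers coprime_XY coprime_XZ coprime_YZ
    is_unit_of_nat_d
  show "squarefree (B\<^sub>z d)"
    by (rule squarefree_if_coprime_derivs[OF D(1,2), of _ "of_nat d" "X ^ (d - 1)" "- of_nat d" "Y ^ (d - 1)"])
       (simp_all add: B\<^sub>z_def simps)
  show "squarefree (F d)"
    by (rule squarefree_if_coprime_derivs[OF D(1,2), of _ "of_nat d" "X ^ (d - 1)" "of_nat d" "Y ^ (d - 1)"])
       (simp_all add: F_def simps)
  show "squarefree (M\<^sub>x d)"
    by (rule squarefree_if_coprime_derivs[OF D(2,3), of _ "2 * of_nat d" "Y ^ (d - 1)" "of_nat d" "Z ^ (d - 1)"])
       (simp_all add: M\<^sub>x_def simps)
  show "squarefree (N\<^sub>y d)"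
    by (rule squarefree_if_coprime_derivs[OF D(1,3), of _ "2 * of_nat d" "X ^ (d - 1)" "of_nat d" "Z ^ (d - 1)"])
       (simp_all add: N\<^sub>y_def simps)
qed

lemma B_const:
  obtains b where "B\<^sub>z d = [:b:]" "b \<noteq> 0"
proof
  show "B\<^sub>z d = [:[:[:0, 1:] ^ d:] - monom 1 d:]"
    by (simp add: B\<^sub>z_def X_power Y_power)
  have "coeff ([:[:0, 1:] ^ d:] - monom 1 d :: complex poly poly) d = -1"
    using d by (simp add: coeff_pCons split: nat.splits)
  then show "[:[:0, 1:] ^ d:] - monom 1 d \<noteq> (0 :: complex poly poly)"
    by (metis coeff_0 neg_equal_0_iff_equal zero_neq_one)
qed

lemma coprime_B_Z: "n > 0 \<Longrightarrow> coprime (B\<^sub>z d) (Z ^ n + [:b:])"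
  by (metis B_const coprime_Z)

text \<open>\<open>B\<^sub>z d\<close> is free of \<open>Z\<close> and the other three are monic in
  \<open>Z\<close>. Any two of those three differ by a constant multiple of
  \<open>B\<^sub>z d\<close>, so a common factor of them also divides
  \<open>B\<^sub>z d\<close>.\<close>

lemma coprime_factors:
  "coprime (B\<^sub>z d) (M\<^sub>x d)" "coprime (B\<^sub>z d) (N\<^sub>y d)" "coprime (M\<^sub>x d) (N\<^sub>y d)"
  "coprime (F d) (B\<^sub>z d)" "coprime (F d) (M\<^sub>x d)" "coprime (F d) (N\<^sub>y d)"
proof -
  have const: "\<exists>b. 2 * Y ^ d = [:b:]" "\<exists>b. 2 * X ^ d = [:b:]" "\<exists>b. X ^ d + Y ^ d = [:b:]"
    by (simp_all add: X_power Y_power numeral_poly)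
  show BM: "coprime (B\<^sub>z d) (M\<^sub>x d)" and BN: "coprime (B\<^sub>z d) (N\<^sub>y d)"
    using d const coprime_B_Z unfolding M\<^sub>x_def N\<^sub>y_def by metis+
  have "coprime (B\<^sub>z d) (F d)"
    using d const(3) coprime_B_Z unfolding F_def by (metis add.commute)
  then show "coprime (F d) (B\<^sub>z d)" by (simp add: coprime_commute)
  have two: "p dvd 2 * f \<Longrightarrow> p dvd f" for p f :: S
    using is_unit_of_nat[of 2] by (simp add: dvd_mult_unit_iff')
  show "coprime (M\<^sub>x d) (N\<^sub>y d)"
  proof (rule coprimeI)
    fix p assume p: "p dvd M\<^sub>x d" "p dvd N\<^sub>y d"
    have "2 * B\<^sub>z d = N\<^sub>y d - M\<^sub>x d" by (simp add: B\<^sub>z_def M\<^sub>x_def N\<^sub>y_def algebra_simps)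
    with p have "p dvd 2 * B\<^sub>z d" by (simp only: dvd_diff)
    then have "p dvd B\<^sub>z d" by (rule two)
    then show "is_unit p" using BM p by (blast intro: coprime_common_divisor)
  qed
  show "coprime (F d) (M\<^sub>x d)"
  proof (rule coprimeI)
    fix p assume p: "p dvd F d" "p dvd M\<^sub>x d"
    have "B\<^sub>z d = F d - M\<^sub>x d" by (simp add: B\<^sub>z_def M\<^sub>x_def F_def algebra_simps)
    then have "p dvd B\<^sub>z d" using p by (simp add: dvd_diff)
    then show "is_unit p" using BM p by (blast intro: coprime_common_divisor)
  qed
  show "coprime (F d) (N\<^sub>y d)"
  proof (rule coprimeI)
    fix p assume p: "p dvd F d" "p dvd N\<^sub>y d"
    have "B\<^sub>z d = N\<^sub>y d - F d" by (simp add: B\<^sub>z_def N\<^sub>y_def F_def algebra_simps)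
    then have "p dvd B\<^sub>z d" using p by (simp add: dvd_diff)
    then show "is_unit p" using BN p by (blast intro: coprime_common_divisor)
  qed
qed

lemma coprime_axes:
  "coprime X (B\<^sub>z d)" "coprime X (M\<^sub>x d)" "coprime X (N\<^sub>y d)"
  "coprime Y (B\<^sub>z d)" "coprime Y (M\<^sub>x d)" "coprime Y (N\<^sub>y d)"
  "coprime Z (B\<^sub>z d)" "coprime Z (M\<^sub>x d)" "coprime Z (N\<^sub>y d)"
proof -
  have const: "\<exists>b. 2 * Y ^ d = [:b:]" "\<exists>b. 2 * X ^ d = [:b:]"
    by (simp_all add: X_power Y_power numeral_poly)
  have XY: "\<exists>b. X = [:b:] \<and> b \<noteq> 0" "\<exists>b. Y = [:b:] \<and> b \<noteq> 0"
    by (simp_all add: X_def Y_def)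
  show "coprime X (M\<^sub>x d)" "coprime X (N\<^sub>y d)" "coprime Y (M\<^sub>x d)" "coprime Y (N\<^sub>y d)"
    using XY const coprime_Z[OF _ d] unfolding M\<^sub>x_def N\<^sub>y_def by metis+
  \<comment> \<open>Modulo \<open>a\<close> only the summand \<open>e\<close> remains, so each case
    reduces to coprimality of two coordinates.\<close>
  have *: "coprime a (b + e)" if "coprime a e" "a dvd b" for a b e :: S
  proof (rule coprimeI)
    fix p assume p: "p dvd a" "p dvd b + e"
    with that(2) have "p dvd e" by (meson dvd_add_right_iff dvd_trans)
    with that(1) p(1) show "is_unit p" by (blast intro: coprime_common_divisor)
  qed
  have unit2: "coprime Z 2"
    using is_unit_of_nat[of 2] by (simp add: is_unit_right_imp_coprime)
  show "coprime X (B\<^sub>z d)"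
    using *[of X "- (Y ^ d)" "X ^ d"] d coprime_XY by (simp add: B\<^sub>z_def)
  show "coprime Y (B\<^sub>z d)"
    using *[of Y "X ^ d" "- (Y ^ d)"] d coprime_XY by (simp add: B\<^sub>z_def coprime_commute)
  show "coprime Z (B\<^sub>z d)"
    using coprime_B_Z[of 1 0] by (simp add: coprime_commute)
  show "coprime Z (M\<^sub>x d)"
    using *[of Z "2 * Y ^ d" "Z ^ d"] d coprime_YZ unit2 by (simp add: M\<^sub>x_def coprime_commute)
  show "coprime Z (N\<^sub>y d)"
    using *[of Z "2 * X ^ d" "Z ^ d"] d coprime_XZ unit2 by (simp add: N\<^sub>y_def coprime_commute)
qed

lemma reduced_products:
  "reduced_curve (3 * d) (B\<^sub>z d * M\<^sub>x d * N\<^sub>y d)"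
  "reduced_curve (3 * d + 3) (X * Y * Z * B\<^sub>z d * M\<^sub>x d * N\<^sub>y d)"
  "reduced_curve (4 * d) (F d * B\<^sub>z d * M\<^sub>x d * N\<^sub>y d)"
proof -
  have hom: "homogeneous d (B\<^sub>z d)" "homogeneous d (M\<^sub>x d)" "homogeneous d (N\<^sub>y d)" "homogeneous d (F d)"
    by (simp_all add: B\<^sub>z_def M\<^sub>x_def N\<^sub>y_def F_def homogeneous_intros)
  note homs = homogeneous_mult[OF homogeneous_mult[OF hom(1,2)] hom(3)]
    homogeneous_mult[OF homogeneous_mult[OF homogeneous_mult[OF homogeneous_mult[OF
      homogeneous_mult[OF homogeneous_axis(1,2)] homogeneous_axis(3)] hom(1)] hom(2)] hom(3)]
    homogeneous_mult[OF homogeneous_mult[OF homogeneous_mult[OF hom(4,1)] hom(2)] hom(3)]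
  have lin: "squarefree X" "squarefree Y" "squarefree Z"
    by (simp_all add: squarefree_linear_form)
  note simps = coprime_factors coprime_axes coprime_XY coprime_XZ coprime_YZ
    squarefree_factors lin
  have "squarefree (B\<^sub>z d * M\<^sub>x d * N\<^sub>y d)"
    "squarefree (X * Y * Z * B\<^sub>z d * M\<^sub>x d * N\<^sub>y d)"
    "squarefree (F d * B\<^sub>z d * M\<^sub>x d * N\<^sub>y d)"
    by (intro squarefree_mult_coprime; simp add: simps)+
  then show "reduced_curve (3 * d) (B\<^sub>z d * M\<^sub>x d * N\<^sub>y d)"
    "reduced_curve (3 * d + 3) (X * Y * Z * B\<^sub>z d * M\<^sub>x d * N\<^sub>y d)"
    "reduced_curve (4 * d) (F d * B\<^sub>z d * M\<^sub>x d * N\<^sub>y d)"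
    unfolding reduced_curve_def using homs d by (simp_all add: eval_nat_numeral add_ac)
qed

end

section \<open>Logarithmic vector fields\<close>

text \<open>Components divisible by their own coordinate restore the exponent lost in
  differentiation, so everything stays polynomial in the \<open>d\<close>-th powers.\<close>

lemma dir_deriv_axis_power:
  assumes "d > 0"
  shows "dir_deriv (a * X, b * Y, c * Z) (X ^ d) = of_nat d * (a * X ^ d)"
    and "dir_deriv (a * X, b * Y, c * Z) (Y ^ d) = of_nat d * (b * Y ^ d)"
    and "dir_deriv (a * X, b * Y, c * Z) (Z ^ d) = of_nat d * (c * Z ^ d)"
  using assms power_minus_mult[of d X] power_minus_mult[of d Y] power_minus_mult[of d Z]
  by (simp_all add: dir_deriv.power mult.assoc mult.left_commute)

lemma dir_deriv_factors:
  fixes a b c :: S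
  assumes "d > 0"
  defines "v \<equiv> (a * X, b * Y, c * Z)"
  shows "dir_deriv v (B\<^sub>z d) = of_nat d * (a * X ^ d - b * Y ^ d)"
    and "dir_deriv v (M\<^sub>x d) = of_nat d * (c * Z ^ d + 2 * (b * Y ^ d))"
    and "dir_deriv v (N\<^sub>y d) = of_nat d * (c * Z ^ d + 2 * (a * X ^ d))"
    and "dir_deriv v (F d) = of_nat d * (a * X ^ d + b * Y ^ d + c * Z ^ d)"
  unfolding v_def B\<^sub>z_def M\<^sub>x_def N\<^sub>y_def F_def
    dir_deriv.add dir_deriv.diff dir_deriv.mult dir_deriv.numeral dir_deriv_axis_power[OF assms(1)]
  by (simp_all add: algebra_simps)

text \<open>With t = (2u, 2v, -w) this is \<open>d\<close> times the sum of t_i^2 d/dt_i. The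
  differences t_i - t_j are 2 \<open>B\<^sub>z d\<close>, \<open>M\<^sub>x d\<close> and
  \<open>N\<^sub>y d\<close>, and they have cofactors t_i + t_j up to \<open>d\<close>.\<close>

definition theta1 :: "nat \<Rightarrow> S \<times> S \<times> S" where
  "theta1 d = (2 * X ^ d * X, 2 * Y ^ d * Y, - (Z ^ d) * Z)"

text \<open>Likewise with t_i^3, giving the cofactors t_i^2 + t_i t_j + t_j^2 up to
  \<open>d\<close>.\<close>

definition theta2 :: "nat \<Rightarrow> S \<times> S \<times> S" where
  "theta2 d = (4 * (X ^ d * X ^ d) * X, 4 * (Y ^ d * Y ^ d) * Y, Z ^ d * Z ^ d * Z)"

text \<open>This is \<open>theta2 - 3 (X\<^sup>d + Y\<^sup>d) theta1\<close>, the combination that is tangent to the Fermat curve.\<close>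

definition theta3 :: "nat \<Rightarrow> S \<times> S \<times> S" where
  "theta3 d =
     ((- (2 * (X ^ d * X ^ d)) - 6 * (X ^ d * Y ^ d)) * X,
      (- (2 * (Y ^ d * Y ^ d)) - 6 * (X ^ d * Y ^ d)) * Y,
      (Z ^ d * Z ^ d + 3 * (X ^ d * Z ^ d) + 3 * (Y ^ d * Z ^ d)) * Z)"

text \<open>Up to the factor \<open>(XYZ)\<^sup>d\<^sup>-\<^sup>1\<close> this is the field with coefficients \<open>X / X\<^sup>d\<close>, \<open>Y / Y\<^sup>d\<close>,
  \<open>-2 Z / Z\<^sup>d\<close>; it annihilates all the factors.\<close>

definition eta :: "nat \<Rightarrow> S \<times> S \<times> S" where
  "eta d = (Y ^ (d - 1) * Z ^ (d - 1), X ^ (d - 1) * Z ^ (d - 1), - (2 * (X ^ (d - 1) * Y ^ (d - 1))))"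

context
  fixes d :: nat
  assumes d: "d > 0"
begin

lemma dir_deriv_euler:
  "dir_deriv (X, Y, Z) (B\<^sub>z d) = of_nat d * B\<^sub>z d" "dir_deriv (X, Y, Z) (M\<^sub>x d) = of_nat d * M\<^sub>x d"
  "dir_deriv (X, Y, Z) (N\<^sub>y d) = of_nat d * N\<^sub>y d" "dir_deriv (X, Y, Z) (F d) = of_nat d * F d"
  using dir_deriv_factors[OF d, of 1 1 1] by (simp_all add: B\<^sub>z_def M\<^sub>x_def N\<^sub>y_def F_def)

lemma dir_deriv_theta1:
  "dir_deriv (theta1 d) (B\<^sub>z d) = (of_nat d * (2 * X ^ d + 2 * Y ^ d)) * B\<^sub>z d"
  "dir_deriv (theta1 d) (M\<^sub>x d) = (of_nat d * (2 * Y ^ d - Z ^ d)) * M\<^sub>x d"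
  "dir_deriv (theta1 d) (N\<^sub>y d) = (of_nat d * (2 * X ^ d - Z ^ d)) * N\<^sub>y d"
  unfolding theta1_def dir_deriv_factors[OF d] unfolding B\<^sub>z_def M\<^sub>x_def N\<^sub>y_def
  by (simp_all add: algebra_simps)

lemma dir_deriv_theta2:
  "dir_deriv (theta2 d) (B\<^sub>z d) =
     (of_nat d * (4 * (X ^ d * X ^ d) + 4 * (X ^ d * Y ^ d) + 4 * (Y ^ d * Y ^ d))) * B\<^sub>z d"
  "dir_deriv (theta2 d) (M\<^sub>x d) =
     (of_nat d * (Z ^ d * Z ^ d - 2 * (Y ^ d * Z ^ d) + 4 * (Y ^ d * Y ^ d))) * M\<^sub>x d"
  "dir_deriv (theta2 d) (N\<^sub>y d) =
     (of_nat d * (Z ^ d * Z ^ d - 2 * (X ^ d * Z ^ d) + 4 * (X ^ d * X ^ d))) * N\<^sub>y d"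
  unfolding theta2_def dir_deriv_factors[OF d] unfolding B\<^sub>z_def M\<^sub>x_def N\<^sub>y_def
  by (simp_all add: algebra_simps)

text \<open>Only the last claim goes beyond \<open>theta1\<close> and \<open>theta2\<close>:
  substituting w = -(u + v) turns 4u^3 + 4v^3 + w^3 into 3(u + v)(2u^2 + 2v^2 - w^2), which explains
  the constant 3.\<close>

lemma dir_deriv_theta3:
  "dir_deriv (theta3 d) (B\<^sub>z d) =
     (of_nat d * (- (2 * (X ^ d * X ^ d)) - 8 * (X ^ d * Y ^ d) - 2 * (Y ^ d * Y ^ d))) * B\<^sub>z d"
  "dir_deriv (theta3 d) (M\<^sub>x d) =
     (of_nat d * (Z ^ d * Z ^ d + Y ^ d * Z ^ d + 3 * (X ^ d * Z ^ d) - 2 * (Y ^ d * Y ^ d)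
        - 6 * (X ^ d * Y ^ d))) * M\<^sub>x d"
  "dir_deriv (theta3 d) (N\<^sub>y d) =
     (of_nat d * (Z ^ d * Z ^ d + X ^ d * Z ^ d + 3 * (Y ^ d * Z ^ d) - 2 * (X ^ d * X ^ d)
        - 6 * (X ^ d * Y ^ d))) * N\<^sub>y d"
  "dir_deriv (theta3 d) (F d) =
     (of_nat d * (Z ^ d * Z ^ d + 2 * (X ^ d * Z ^ d) + 2 * (Y ^ d * Z ^ d) - 2 * (X ^ d * X ^ d)
        - 4 * (X ^ d * Y ^ d) - 2 * (Y ^ d * Y ^ d))) * F d"
  unfolding theta3_def dir_deriv_factors[OF d] unfolding B\<^sub>z_def M\<^sub>x_def N\<^sub>y_def F_def
  by (simp_all add: algebra_simps)

text \<open>In the coordinates t the field is proportional to the sum of the d/dt_i. It kills all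
  differences t_i - t_j, and also \<open>F d\<close>, whose coefficients 1/2, 1/2, -1 sum to zero.
  The form \<open>0 * _\<close> fits \<open>log_mult\<close>.\<close>

lemma dir_deriv_eta:
  "dir_deriv (eta d) (B\<^sub>z d) = 0 * B\<^sub>z d" "dir_deriv (eta d) (M\<^sub>x d) = 0 * M\<^sub>x d"
  "dir_deriv (eta d) (N\<^sub>y d) = 0 * N\<^sub>y d" "dir_deriv (eta d) (F d) = 0 * F d"
  by (simp_all add: eta_def B\<^sub>z_def M\<^sub>x_def N\<^sub>y_def F_def dir_deriv.add dir_deriv.diff dir_deriv.mult
      dir_deriv.power[OF d] algebra_simps)

lemma homogeneous_monomials:
  "homogeneous (d + d) (X ^ d * X ^ d)" "homogeneous (d + d) (X ^ d * Y ^ d)"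
  "homogeneous (d + d) (Y ^ d * Y ^ d)" "homogeneous (d + d) (X ^ d * Z ^ d)"
  "homogeneous (d + d) (Y ^ d * Z ^ d)" "homogeneous (d + d) (Z ^ d * Z ^ d)"
  by (intro homogeneous_mult homogeneous_axis_power)+

text \<open>Scalars are limited to naturals and numerals, so that a monomial such as
  \<open>X ^ d * Y ^ d\<close> is not split into a constant and a form.\<close>

lemmas homogeneous_form_intros = homogeneous_add homogeneous_diff homogeneous_minus
  homogeneous_mult_const[OF homogeneous_of_nat] homogeneous_mult_const[OF homogeneous_numeral]
  homogeneous_axis_power homogeneous_monomials

lemma homogeneous_theta:
  "homogeneous3 (Suc d) (theta1 d)" "homogeneous3 (Suc (d + d)) (theta2 d)"
  "homogeneous3 (Suc (d + d)) (theta3 d)"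
  unfolding theta1_def theta2_def theta3_def homogeneous3_def split_conv
  by (intro conjI homogeneous_mult_linear homogeneous_axis homogeneous_form_intros)+

lemma homogeneous_eta: "homogeneous3 (d - 1 + (d - 1)) (eta d)"
  unfolding eta_def homogeneous3_def split_conv
  by (intro conjI homogeneous_minus homogeneous_mult_const[OF homogeneous_numeral]
      homogeneous_mult homogeneous_axis_power)

text \<open>Pulling \<open>X\<close>, \<open>Y\<close>, \<open>Z\<close> out of the columns leaves
  the Vandermonde determinant of 2u, 2v, -w, equal to (-2 \<open>B\<^sub>z d\<close>)(-
  \<open>N\<^sub>y d\<close>)(- \<open>M\<^sub>x d\<close>).\<close>

lemma det_theta1_theta2:
  "det3 (X, Y, Z) (theta1 d) (theta2 d) = - 2 * (X * Y * Z * B\<^sub>z d * M\<^sub>x d * N\<^sub>y d)"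
  by (simp add: det3_def theta1_def theta2_def B\<^sub>z_def M\<^sub>x_def N\<^sub>y_def algebra_simps)

text \<open>Clearing the denominators of the rows 1, t, 1/t gives the Vandermonde determinant again.
  With \<open>theta2\<close> in place of \<open>theta3\<close> the second determinant has the extra
  factor -(t_1 + t_2 + t_3) = w - 2u - 2v; the \<open>theta1\<close> part adds 3(u + v), and the sum
  is \<open>F d\<close>.\<close>

lemma det_eta:
  "det3 (X, Y, Z) (theta1 d) (eta d) = B\<^sub>z d * M\<^sub>x d * N\<^sub>y d"
  "det3 (X, Y, Z) (eta d) (theta3 d) = F d * B\<^sub>z d * M\<^sub>x d * N\<^sub>y d"
proof -
  \<comment> \<open>This removes the truncated subtraction in \<open>d - 1\<close>.\<close>
  obtain e where e: "d = Suc e" using d by (cases d) auto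
  show "det3 (X, Y, Z) (theta1 d) (eta d) = B\<^sub>z d * M\<^sub>x d * N\<^sub>y d"
    by (simp add: e det3_def theta1_def eta_def B\<^sub>z_def M\<^sub>x_def N\<^sub>y_def algebra_simps)
  show "det3 (X, Y, Z) (eta d) (theta3 d) = F d * B\<^sub>z d * M\<^sub>x d * N\<^sub>y d"
    by (simp add: e det3_def theta3_def eta_def B\<^sub>z_def M\<^sub>x_def N\<^sub>y_def F_def algebra_simps)
qed

section \<open>Freeness of the three curves\<close>

lemma is_unit_minus_2: "is_unit (- 2 :: S)"
  using is_unit_of_nat[of 2] by simp

lemma free_lines:
  assumes "d \<ge> 2"
  shows "free_curve (B\<^sub>z d * M\<^sub>x d * N\<^sub>y d) (3 * d) (Suc d, Suc (2 * d - 3))"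
    (is "free_curve ?P _ _")
proof -
  note log = dir_deriv.log_mult[OF dir_deriv.log_mult]
  have euler: "dir_deriv (X, Y, Z) ?P = of_nat (3 * d) * ?P"
    using log[OF dir_deriv_euler(1-3)] by simp
  note log1 = log[OF dir_deriv_theta1]
  have log2: "dir_deriv (eta d) ?P = 0 * ?P" using log[OF dir_deriv_eta(1-3)] by simp
  \<comment> \<open>For \<open>d = 1\<close> the truncated difference would give the wrong degree.
    The cofactor 0 of \<open>eta\<close> counts as homogeneous of degree
    \<open>2 * d - 3\<close>.\<close>
  have "Suc (2 * d - 3) = d - 1 + (d - 1)" using assms by simp
  then have hom: "homogeneous3 (Suc (2 * d - 3)) (eta d)" using homogeneous_eta by simp
  have det: "det3 (X, Y, Z) (theta1 d) (eta d) = 1 * ?P" by (simp add: det_eta)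
  have "d + (2 * d - 3) + 3 = 3 * d" using assms by simp
  from free_curve_if_logarithmic[OF reduced_products(1)[OF d] euler this log1
      homogeneous_theta(1) _ log2 hom homogeneous_0 det]
  show ?thesis by this (intro homogeneous_form_intros one_dvd)+
qed

text \<open>The components of \<open>theta1\<close> and \<open>theta2\<close> are divisible by their
  own coordinates, so both fields are tangent to the axes; \<open>eta\<close> is not.\<close>

lemma free_lines_and_axes:
  "free_curve (X * Y * Z * B\<^sub>z d * M\<^sub>x d * N\<^sub>y d) (3 * d + 3) (Suc d, Suc (d + d))"
    (is "free_curve ?P _ _")
proof -
  have axis: "dir_deriv (a * X, b * Y, c * Z) X = a * X" "dir_deriv (a * X, b * Y, c * Z) Y = b * Y"
    "dir_deriv (a * X, b * Y, c * Z) Z = c * Z" for a b c by simp_all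
  note log = dir_deriv.log_mult[OF dir_deriv.log_mult[OF dir_deriv.log_mult[OF dir_deriv.log_mult[OF
    dir_deriv.log_mult]]]]
  have "dir_deriv (X, Y, Z) X = 1 * X" "dir_deriv (X, Y, Z) Y = 1 * Y" "dir_deriv (X, Y, Z) Z = 1 * Z"
    by simp_all
  from log[OF this dir_deriv_euler(1-3)]
  have euler: "dir_deriv (X, Y, Z) ?P = of_nat (3 * d + 3) * ?P" by (simp add: add_ac)
  note log1 = log[OF axis[of "2 * X ^ d" "2 * Y ^ d" "- (Z ^ d)", folded theta1_def] dir_deriv_theta1]
  note log2 = log[OF axis[of "4 * (X ^ d * X ^ d)" "4 * (Y ^ d * Y ^ d)" "Z ^ d * Z ^ d",
        folded theta2_def] dir_deriv_theta2]
  have "d + (d + d) + 3 = 3 * d + 3" by simp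
  from free_curve_if_logarithmic[OF reduced_products(2)[OF d] euler this log1 homogeneous_theta(1) _
      log2 homogeneous_theta(2) _ det_theta1_theta2 is_unit_minus_2]
  show ?thesis by this (intro homogeneous_form_intros one_dvd)+
qed

text \<open>\<open>theta1\<close> is not tangent to the Fermat curve; its replacement
  \<open>theta3\<close> has degree higher by \<open>d\<close>, matching the added factor.\<close>

lemma free_fermat_and_lines:
  assumes "d \<ge> 2"
  shows "free_curve (F d * B\<^sub>z d * M\<^sub>x d * N\<^sub>y d) (4 * d) (Suc (2 * d - 3), Suc (d + d))"
    (is "free_curve ?P _ _")
proof -
  note log = dir_deriv.log_mult[OF dir_deriv.log_mult[OF dir_deriv.log_mult]]
  have euler: "dir_deriv (X, Y, Z) ?P = of_nat (4 * d) * ?P"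
    using log[OF dir_deriv_euler(4,1-3)] by simp
  have log1: "dir_deriv (eta d) ?P = 0 * ?P" using log[OF dir_deriv_eta(4,1-3)] by simp
  note log2 = log[OF dir_deriv_theta3(4,1-3)]
  have "Suc (2 * d - 3) = d - 1 + (d - 1)" using assms by simp
  then have hom: "homogeneous3 (Suc (2 * d - 3)) (eta d)" using homogeneous_eta by simp
  have det: "det3 (X, Y, Z) (eta d) (theta3 d) = 1 * ?P" by (simp add: det_eta)
  have "2 * d - 3 + (d + d) + 3 = 4 * d" using assms by simp
  from free_curve_if_logarithmic[OF reduced_products(3)[OF d] euler this log1 hom homogeneous_0
      log2 homogeneous_theta(3) _ det]
  show ?thesis by this (intro homogeneous_form_intros one_dvd)+
qed

end

section \<open>Factorization into linear forms\<close>

text \<open>Both sides are monic of degree \<open>d\<close>, so a nonzero difference would have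
  degree below \<open>d\<close> and yet vanish at all \<open>d\<close> roots.\<close>

lemma prod_linear_roots:
  fixes c :: complex
  assumes "c \<noteq> 0" "d > 0"
  shows "(\<Prod>\<omega> | \<omega> ^ d = c. [:- \<omega>, 1:]) = monom 1 d - [:c:]" (is "?p = ?q")
proof -
  let ?R = "{\<omega>. \<omega> ^ d = c}"
  have fin: "finite ?R" and card: "card ?R = d"
    using assms finite_nth_roots card_nth_roots by auto
  have deg: "degree ?p = d" by (subst degree_prod_eq_sum_degree) (simp_all add: card)
  have "lead_coeff ?p = 1" by (simp add: lead_coeff_prod)
  then have coeff: "coeff (?p - ?q) d = 0"
    using assms(2) deg by (simp add: coeff_pCons split: nat.splits)
  have "degree (?p - ?q) \<le> d"
    by (intro degree_diff_le) (simp_all add: deg degree_monom_le)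
  show ?thesis
  proof (rule ccontr)
    assume "?p \<noteq> ?q"
    then have nz: "?p - ?q \<noteq> 0" by simp
    have "degree (?p - ?q) \<noteq> d" using nz coeff by (metis leading_coeff_0_iff)
    with \<open>degree (?p - ?q) \<le> d\<close> have "degree (?p - ?q) < d" by simp
    moreover have "?R \<subseteq> {x. poly (?p - ?q) x = 0}"
      using fin by (auto simp: poly_prod poly_monom)
    then have "d \<le> card {x. poly (?p - ?q) x = 0}"
      using card poly_roots_finite[OF nz] card_mono by metis
    moreover have "card {x. poly (?p - ?q) x = 0} \<le> degree (?p - ?q)"
      by (rule card_poly_roots_bound[OF nz])
    ultimately show False by simp
  qed
qed

definition const3 :: "complex \<Rightarrow> S" where
  "const3 c = [:[:[:c:]:]:]"

lemma const3_simps [simp]: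
  "const3 0 = 0" "const3 1 = 1" "const3 (numeral n) = numeral n" "const3 (- a) = - const3 a"
  "const3 (a - b) = const3 a - const3 b" "const3 (a * b) = const3 a * const3 b"
  "const3 a = const3 b \<longleftrightarrow> a = b" "const3 a = 0 \<longleftrightarrow> a = 0"
  by (simp_all add: const3_def one_pCons numeral_poly)

text \<open>Homogenization carries the one-variable factorization to arbitrary \<open>x\<close>,
  \<open>y\<close> in \<open>S\<close> without dividing by \<open>y\<close>.\<close>

lemma prod_linear_homogenize:
  assumes "finite A"
  shows "(\<Prod>\<omega>\<in>A. x - const3 \<omega> * y) =
    (\<Sum>k\<le>card A. const3 (coeff (\<Prod>\<omega>\<in>A. [:- \<omega>, 1:]) k) * x ^ k * y ^ (card A - k))"
  using assms
proof (induction A)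
  case empty
  show ?case by simp
next
  case (insert \<omega> A)
  let ?p = "\<Prod>\<omega>\<in>A. [:- \<omega>, 1:]" and ?n = "card A"
  let ?h = "\<lambda>k. const3 (coeff ?p k)"
  have deg: "degree ?p = ?n" by (subst degree_prod_eq_sum_degree) simp_all
  have coeff: "const3 (coeff ([:- \<omega>, 1:] * ?p) k) =
      (case k of 0 \<Rightarrow> 0 | Suc j \<Rightarrow> ?h j) - const3 \<omega> * ?h k" for k
    by (cases k) simp_all
  have "(\<Sum>k\<le>Suc ?n. const3 (coeff ([:- \<omega>, 1:] * ?p) k) * x ^ k * y ^ (Suc ?n - k)) =
      (\<Sum>k\<le>Suc ?n. (case k of 0 \<Rightarrow> 0 | Suc j \<Rightarrow> ?h j) * x ^ k * y ^ (Suc ?n - k)) -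
      (\<Sum>k\<le>Suc ?n. const3 \<omega> * ?h k * x ^ k * y ^ (Suc ?n - k))"
    unfolding coeff by (simp add: left_diff_distrib sum_subtractf)
  also have "(\<Sum>k\<le>Suc ?n. (case k of 0 \<Rightarrow> 0 | Suc j \<Rightarrow> ?h j) * x ^ k * y ^ (Suc ?n - k)) =
      x * (\<Sum>k\<le>?n. ?h k * x ^ k * y ^ (?n - k))"
    by (subst sum.atMost_Suc_shift) (simp add: sum_distrib_left mult_ac)
  also have "(\<Sum>k\<le>Suc ?n. const3 \<omega> * ?h k * x ^ k * y ^ (Suc ?n - k)) =
      const3 \<omega> * y * (\<Sum>k\<le>?n. ?h k * x ^ k * y ^ (?n - k))"
  proof -
    \<comment> \<open>The two sums differ in their ranges only by this top term.\<close>
    have "?h (Suc ?n) = 0" using deg by (simp add: coeff_eq_0)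
    then show ?thesis
      unfolding sum.atMost_Suc sum_distrib_left
      by (auto simp: Suc_diff_le mult_ac intro!: sum.cong)
  qed
  finally show ?case using insert by (simp add: left_diff_distrib)
qed

lemma power_diff_factorization:
  assumes "c \<noteq> 0" "d > 0"
  shows "x ^ d - const3 c * y ^ d = (\<Prod>\<omega> | \<omega> ^ d = c. x - const3 \<omega> * y)"
proof -
  have fin: "finite {\<omega>. \<omega> ^ d = c}" and card: "card {\<omega>. \<omega> ^ d = c} = d"
    using assms finite_nth_roots card_nth_roots by auto
  \<comment> \<open>Only the extreme coefficients survive, and \<open>d > 0\<close> keeps them
    apart.\<close>
  have coeff: "const3 (coeff (monom 1 d - [:c:]) k) * x ^ k * y ^ (d - k) =
      (if k = d then x ^ d else 0) - (if k = 0 then const3 c * y ^ d else 0)" for k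
    using assms(2) by (auto simp: coeff_pCons split: nat.splits)
  show ?thesis
    unfolding prod_linear_homogenize[OF fin] card prod_linear_roots[OF assms] coeff
    by (simp add: sum_subtractf)
qed

lemma deriv_const3 [simp]:
  "deriv_x (const3 c) = 0" "deriv_y (const3 c) = 0" "deriv_z (const3 c) = 0"
  by (simp_all add: const3_def deriv_x_def deriv_y_def deriv_z_def map_poly_pCons pderiv_pCons)

text \<open>\<open>line_arrangement\<close> wants a product over a set, so distinct roots must give
  distinct forms; this is where \<open>y\<close> must be nonzero.\<close>

lemma power_diff_linear_factors:
  assumes "c \<noteq> 0" "d > 0" "y \<noteq> 0"
  shows "x ^ d - const3 c * y ^ d = \<Prod>((\<lambda>\<omega>. x - const3 \<omega> * y) ` {\<omega>. \<omega> ^ d = c})"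
proof -
  have "inj (\<lambda>\<omega>. x - const3 \<omega> * y)"
    using assms(3) by (intro injI) simp
  then have "inj_on (\<lambda>\<omega>. x - const3 \<omega> * y) {\<omega>. \<omega> ^ d = c}" by (rule inj_on_subset) simp
  then show ?thesis by (simp only: power_diff_factorization[OF assms(1,2)] prod.reindex o_def)
qed

lemma line_arrangement_lines:
  assumes "d > 0"
  shows "line_arrangement (B\<^sub>z d * M\<^sub>x d * N\<^sub>y d)"
proof -
  define L where "L x y c = (\<lambda>\<omega>. x - const3 \<omega> * y) ` {\<omega>. \<omega> ^ d = c}" for x y :: S and c
  have fin: "finite (L x y c)" if "c \<noteq> 0" for x y c
    unfolding L_def using that assms finite_nth_roots by auto
  have XYZ: "X \<noteq> 0" "Y \<noteq> 0" "Z \<noteq> 0" by (simp_all add: X_def Y_def Z_def)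
  have prods: "B\<^sub>z d = \<Prod>(L X Y 1)" "M\<^sub>x d = \<Prod>(L Z Y (- 2))" "N\<^sub>y d = \<Prod>(L Z X (- 2))"
    using power_diff_linear_factors[of 1 d Y X] power_diff_linear_factors[of "- 2" d Y Z]
      power_diff_linear_factors[of "- 2" d X Z] XYZ assms
    unfolding L_def B\<^sub>z_def M\<^sub>x_def N\<^sub>y_def by simp_all
  \<comment> \<open>Partial derivatives separate the three families: \<open>deriv_z\<close> singles
    out the first, \<open>deriv_x\<close> distinguishes the other two, since a \<open>d\<close>-th
    root of -2 is nonzero.\<close>
  have dz: "deriv_z l = 0" if "l \<in> L X Y 1" for l
    using that by (auto simp: L_def deriv_z.diff deriv_z.mult)
  have dz': "deriv_z l = 1" if "l \<in> L Z Y (- 2) \<union> L Z X (- 2)" for l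
    using that by (auto simp: L_def deriv_z.diff deriv_z.mult)
  have dx: "deriv_x l = 0" if "l \<in> L Z Y (- 2)" for l
    using that by (auto simp: L_def deriv_x.diff deriv_x.mult)
  have dx': "deriv_x l \<noteq> 0" if "l \<in> L Z X (- 2)" for l
    using that assms by (auto simp: L_def deriv_x.diff deriv_x.mult power_0_left)
  have disj: "L X Y 1 \<inter> L Z Y (- 2) = {}" "(L X Y 1 \<union> L Z Y (- 2)) \<inter> L Z X (- 2) = {}"
    using dz dz' dx dx' by fastforce+
  let ?L = "L X Y 1 \<union> L Z Y (- 2) \<union> L Z X (- 2)"
  have "B\<^sub>z d * M\<^sub>x d * N\<^sub>y d = \<Prod>?L"
    unfolding prods using fin disj by (simp add: prod.union_disjoint)
  moreover have "\<forall>l\<in>?L. homogeneous 1 l"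
    using homogeneous_axis unfolding L_def One_nat_def
    by (auto intro!: homogeneous_diff homogeneous_mult_const[OF homogeneous_const[folded const3_def]])
  moreover have "finite ?L" using fin by simp
  moreover have "squarefree (B\<^sub>z d * M\<^sub>x d * N\<^sub>y d)"
    using reduced_products(1)[OF assms] by (simp add: reduced_curve_def)
  ultimately show ?thesis unfolding line_arrangement_def by (intro conjI exI[of _ ?L])
qed

theorem theorem3p8:
  fixes d :: nat
  assumes "d \<ge> 3"
  shows "line_arrangement (B\<^sub>z d * M\<^sub>x d * N\<^sub>y d) \<and>
         free_curve (B\<^sub>z d * M\<^sub>x d * N\<^sub>y d) (3 * d) (d + 1, 2 * d - 2) \<and>
         free_curve (X * Y * Z * B\<^sub>z d * M\<^sub>x d * N\<^sub>y d) (3 * d + 3) (d + 1, 2 * d + 1) \<and>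
         free_curve (F d * B\<^sub>z d * M\<^sub>x d * N\<^sub>y d) (4 * d) (2 * d - 2, 2 * d + 1)"
proof -
  have d: "d > 0" "d \<ge> 2" using assms by simp_all
  have degs: "Suc (2 * d - 3) = 2 * d - 2" "Suc (d + d) = 2 * d + 1" "Suc d = d + 1"
    using assms by simp_all
  show ?thesis
    using free_lines[OF d] free_lines_and_axes[OF d(1)] free_fermat_and_lines[OF d]
    unfolding degs by (intro conjI line_arrangement_lines[OF d(1)])
qed

end
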